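(* Let $S\subseteq\mathbb{R}^n$ be a nonempty closed subset and let $\mu$ be a Borel probability measure on $\mathbb{R}^n$ such that $\mu(\mathbb{R}^n\setminus S)=0$. If $h(S)<\infty$, then $\mathcal{F}(S,\mu)\ge h(S)^{-1}$.
   Context: For a Borel probability measure $\mu$ on $\mathbb{R}^n$ and a nonempty closed $S\subseteq\mathbb{R}^n$, $\mathcal{F}(S,\mu):=\max_{x\in S}\inf_{u\in\mathcal{S}^{n-1}}\mu(H^+(u,x))$, where $\mathcal{S}^{n-1}$ is the unit sphere in $\mathbb{R}^n$ and $H^+(u,x)=\{y\in\mathbb{R}^n:u\cdot(y-x)\ge0\}$. Helly number of $S$: let $\mathcal{K}:=\{S\cap K: K\subseteq\mathbb{R}^n\text{ convex}\}$. Then $h=h(S)\in\mathbb{N}$ is the smallest number such that for all finite subsets $\{C_1,\dots,C_m\}\subseteq\mathcal{K}$: if $C_{i_1}\cap\dots\cap C_{i_h}\neq\emptyset$ for all $\{i_1,\dots,i_h\}\subseteq\{1,\dots,m\}$, then $C_1\cap\dots\cap C_m\ne\emptyset$. If no such number exists, $h(S)=\infty$. *)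

theory Defs
  imports "HOL-Probability.Probability" "HOL-Library.Extended_Nat"
begin

definition closed_halfspace :: "real ^ 'n \<Rightarrow> real ^ 'n \<Rightarrow> (real ^ 'n) set" where
  "closed_halfspace u x = {y. u \<bullet> (y - x) \<ge> 0}"

definition halfspace_depth :: "(real ^ 'n) measure \<Rightarrow> real ^ 'n \<Rightarrow> real" where
  "halfspace_depth \<mu> x = (INF u \<in> sphere 0 1. measure \<mu> (closed_halfspace u x))"

(* A genuine maximum, not a supremum: the value is determined only because the maximum
   is attained when S is nonempty and closed and \<mu> is a Borel probability measure. *)
definition max_depth :: "(real ^ 'n) set \<Rightarrow> (real ^ 'n) measure \<Rightarrow> real" where
  "max_depth S \<mu> = (GREATEST v. v \<in> halfspace_depth \<mu> ` S)"

definition convex_traces :: "(real ^ 'n) set \<Rightarrow> (real ^ 'n) set set" where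
  "convex_traces S = {S \<inter> K | K. convex K}"

(* The indices i 1, ..., i h need not be distinct. Otherwise the hypothesis would be vacuous
   for m < h, and no h \<ge> 2 could have the property (take m = 1 and C 1 = {}). *)
definition helly_property :: "(real ^ 'n) set \<Rightarrow> nat \<Rightarrow> bool" where
  "helly_property S h \<longleftrightarrow>
     (\<forall>m (C :: nat \<Rightarrow> (real ^ 'n) set).
        (\<forall>k \<in> {1..m}. C k \<in> convex_traces S) \<longrightarrow>
        (\<forall>i. (\<forall>j \<in> {1..h}. i j \<in> {1..m}) \<longrightarrow> (\<Inter>j \<in> {1..h}. C (i j)) \<noteq> {}) \<longrightarrow>
        (\<Inter>k \<in> {1..m}. C k) \<noteq> {})"

definition helly_number :: "(real ^ 'n) set \<Rightarrow> enat" where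
  "helly_number S =
     (if \<exists>h. helly_property S h then enat (LEAST h. helly_property S h) else \<infinity>)"

end

theory Submission
  imports Defs
begin

text \<open>
  Call a closed convex set \<^emph>\<open>heavy\<close> at level \<open>\<alpha>\<close> if its measure exceeds \<open>1 - \<alpha>\<close>. The proof
  rests on a dual description of depth: a point has depth at least \<open>\<alpha>\<close> precisely when it lies in
  every heavy set (\<open>le_halfspace_depth_iff\<close>). A heavy set that misses the point is separated
  from it by a halfspace that is too light; conversely, a light halfspace at the point has an open
  complement of measure above \<open>1 - \<alpha>\<close>, and shrinking this complement slightly gives a heavy set
  that misses the point.

  Deep points of \<open>S\<close> are thus common points of \<open>S\<close> and a family of closed convex sets. For
  \<open>\<alpha> > 0\<close> some large ball is heavy, so by compactness only finite subfamilies matter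
  (\<open>deep_point_if_heavy_fip\<close>). This is used twice.

  First, take \<open>\<alpha> = 1 / h\<close> with \<open>h\<close> the Helly number. The complements of \<open>h\<close> heavy sets have
  total measure less than \<open>1\<close>, so they cannot cover \<open>S\<close>, which has full measure; hence any
  \<open>h\<close> heavy sets share a point of \<open>S\<close>, and the Helly property passes from \<open>h\<close> sets to any
  finite number. This gives a point of \<open>S\<close> of depth at least \<open>1 / h\<close>. Second, take for \<open>\<alpha>\<close> the
  supremum of the depth over \<open>S\<close>, which is now known to be positive. Finitely many heavy sets
  remain heavy at a slightly smaller level, and a point of \<open>S\<close> whose depth reaches that level lies
  in all of them. So the supremum is attained, as the definition of the maximal depth demands.
\<close>

section \<open>Depth and heavy convex sets\<close>

definition heavy_sets :: "(real ^ 'n) measure \<Rightarrow> real \<Rightarrow> (real ^ 'n) set set" where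
  "heavy_sets \<mu> \<alpha> = {K. closed K \<and> convex K \<and> 1 - \<alpha> < measure \<mu> K}"

lemma heavy_setsD:
  assumes "K \<in> heavy_sets \<mu> \<alpha>"
  shows "closed K" and "convex K" and "1 - \<alpha> < measure \<mu> K"
  using assms by (auto simp: heavy_sets_def)

lemma sphere_cart_nonempty: "sphere (0 :: real ^ 'n) 1 \<noteq> {}"
  by simp

lemma closed_closed_halfspace: "closed (closed_halfspace u x)"
proof -
  have "closed_halfspace u x = {y. u \<bullet> x \<le> u \<bullet> y}"
    by (auto simp: closed_halfspace_def inner_diff_right)
  then show ?thesis
    by (simp add: closed_Collect_le continuous_intros)
qed

lemma halfspace_depth_le:
  assumes "u \<in> sphere 0 1"
  shows "halfspace_depth \<mu> x \<le> measure \<mu> (closed_halfspace u x)"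
  unfolding halfspace_depth_def
  by (rule cINF_lower[OF bdd_belowI2[where m = 0] assms]) simp

text \<open>
  The separating hyperplane theorem, with a unit normal. The normal that it yields may vanish when
  \<open>K\<close> is empty, but then every halfspace serves.
\<close>

lemma halfspace_disjoint_from_closed_convex:
  fixes K :: "(real ^ 'n) set"
  assumes "closed K" and "convex K" and "x \<notin> K"
  obtains u where "u \<in> sphere 0 1" and "K \<inter> closed_halfspace u x = {}"
proof -
  obtain a b where ab: "a \<bullet> x < b" "\<And>y. y \<in> K \<Longrightarrow> b < a \<bullet> y"
    using separating_hyperplane_closed_point[OF assms(2,1,3)] by blast
  show thesis
  proof (cases "a = 0")
    case True
    with ab have "K = {}" by fastforce
    moreover obtain u :: "real ^ 'n" where "u \<in> sphere 0 1"
      using sphere_cart_nonempty by blast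
    ultimately show thesis using that by blast
  next
    case False
    define u where "u = - (inverse (norm a) *\<^sub>R a)"
    have "u \<in> sphere 0 1"
      using False by (simp add: u_def)
    moreover have "u \<bullet> (y - x) < 0" if "y \<in> K" for y
    proof -
      have "0 < a \<bullet> (y - x)"
        using ab(1) ab(2)[OF that] by (simp add: inner_diff_right)
      then show ?thesis
        using False by (simp add: u_def)
    qed
    then have "K \<inter> closed_halfspace u x = {}"
      by (force simp: closed_halfspace_def)
    ultimately show thesis by (rule that)
  qed
qed

text \<open>
  The complement of the halfspace is the increasing union of closed halfspaces at distance
  \<open>1 / (k + 1)\<close> from \<open>x\<close>, so one of them already captures enough of its measure.
\<close>

lemma heavy_set_avoiding_point:
  fixes \<mu> :: "(real ^ 'n) measure"
  assumes "prob_space \<mu>" and sets: "sets \<mu> = sets borel"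
    and light: "measure \<mu> (closed_halfspace u x) < \<alpha>"
  obtains K where "K \<in> heavy_sets \<mu> \<alpha>" and "x \<notin> K"
proof -
  interpret prob_space \<mu> by fact
  have space: "space \<mu> = UNIV"
    using sets_eq_imp_space_eq[OF sets] by simp
  define K where "K k = {y. u \<bullet> y \<le> u \<bullet> x - inverse (real (Suc k))}" for k
  have closed: "closed (K k)" for k
    unfolding K_def by (rule closed_halfspace_le)
  have "incseq K"
  proof (rule incseq_SucI)
    show "K k \<subseteq> K (Suc k)" for k
    proof -
      have "inverse (real (Suc (Suc k))) \<le> inverse (real (Suc k))"
        by (rule le_imp_inverse_le) auto
      then show ?thesis
        unfolding K_def by (intro Collect_mono impI) linarith
    qed
  qed
  then have "(\<lambda>k. measure \<mu> (K k)) \<longlonglongrightarrow> measure \<mu> (\<Union>k. K k)"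
    using closed by (intro finite_Lim_measure_incseq) (auto simp: sets)
  moreover have "(\<Union>k. K k) = UNIV - closed_halfspace u x"
  proof (intro equalityI subsetI)
    fix y assume "y \<in> (\<Union>k. K k)"
    then obtain k where "u \<bullet> y \<le> u \<bullet> x - inverse (real (Suc k))"
      by (auto simp: K_def)
    moreover have "0 < inverse (real (Suc k))" by simp
    ultimately have "u \<bullet> y < u \<bullet> x" by linarith
    then show "y \<in> UNIV - closed_halfspace u x"
      by (simp add: closed_halfspace_def inner_diff_right)
  next
    fix y assume "y \<in> UNIV - closed_halfspace u x"
    then have "0 < u \<bullet> x - u \<bullet> y"
      by (simp add: closed_halfspace_def inner_diff_right)
    then obtain k where "inverse (real (Suc k)) < u \<bullet> x - u \<bullet> y"
      using reals_Archimedean by blast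
    then show "y \<in> (\<Union>k. K k)"
      by (auto simp: K_def simp del: of_nat_Suc intro!: exI[of _ k])
  qed
  moreover have "measure \<mu> (UNIV - closed_halfspace u x) = 1 - measure \<mu> (closed_halfspace u x)"
    using prob_compl[of "closed_halfspace u x"] closed_closed_halfspace[of u x]
    by (simp add: sets space)
  ultimately have "\<forall>\<^sub>F k in sequentially. 1 - \<alpha> < measure \<mu> (K k)"
    using light by (intro order_tendstoD(1)) auto
  then obtain k where "1 - \<alpha> < measure \<mu> (K k)"
    using eventually_happens by force
  then have "K k \<in> heavy_sets \<mu> \<alpha>"
    using closed by (simp add: heavy_sets_def K_def convex_halfspace_le)
  moreover have "x \<notin> K k"
    by (simp add: K_def del: of_nat_Suc)
  ultimately show thesis by (rule that)
qed

lemma le_halfspace_depth_iff: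
  fixes \<mu> :: "(real ^ 'n) measure"
  assumes "prob_space \<mu>" and sets: "sets \<mu> = sets borel"
  shows "\<alpha> \<le> halfspace_depth \<mu> x \<longleftrightarrow> x \<in> \<Inter>(heavy_sets \<mu> \<alpha>)"
proof
  interpret prob_space \<mu> by fact
  assume deep: "\<alpha> \<le> halfspace_depth \<mu> x"
  show "x \<in> \<Inter>(heavy_sets \<mu> \<alpha>)"
  proof (rule InterI, rule ccontr)
    fix K assume K: "K \<in> heavy_sets \<mu> \<alpha>" and "x \<notin> K"
    then obtain u where u: "u \<in> sphere 0 1" "K \<inter> closed_halfspace u x = {}"
      using halfspace_disjoint_from_closed_convex heavy_setsD(1,2) by metis
    have "measure \<mu> K + measure \<mu> (closed_halfspace u x)
        = measure \<mu> (K \<union> closed_halfspace u x)"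
      using heavy_setsD(1)[OF K] closed_closed_halfspace[of u x] u(2)
      by (intro finite_measure_Union[symmetric]) (auto simp: sets)
    also have "\<dots> \<le> 1" by simp
    finally show False
      using heavy_setsD(3)[OF K] halfspace_depth_le[OF u(1), of \<mu> x] deep by linarith
  qed
next
  assume x: "x \<in> \<Inter>(heavy_sets \<mu> \<alpha>)"
  show "\<alpha> \<le> halfspace_depth \<mu> x"
    unfolding halfspace_depth_def
  proof (rule cINF_greatest[OF sphere_cart_nonempty], rule ccontr)
    fix u assume "\<not> \<alpha> \<le> measure \<mu> (closed_halfspace u x)"
    then obtain K where "K \<in> heavy_sets \<mu> \<alpha>" "x \<notin> K"
      using heavy_set_avoiding_point[OF assms, of u x \<alpha>] by auto
    with x show False by blast
  qed
qed

section \<open>Compactness\<close>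

lemma cball_heavy:
  fixes \<mu> :: "(real ^ 'n) measure"
  assumes "prob_space \<mu>" and sets: "sets \<mu> = sets borel" and "0 < \<alpha>"
  obtains r where "cball 0 r \<in> heavy_sets \<mu> \<alpha>"
proof -
  interpret prob_space \<mu> by fact
  have space: "space \<mu> = UNIV"
    using sets_eq_imp_space_eq[OF sets] by simp
  have "(\<lambda>k. measure \<mu> (cball 0 (real k))) \<longlonglongrightarrow> measure \<mu> (\<Union>k. cball 0 (real k))"
    by (intro finite_Lim_measure_incseq) (auto simp: sets incseq_def)
  moreover have "(\<Union>k. cball (0 :: real ^ 'n) (real k)) = UNIV"
    using real_arch_simple by auto
  moreover have "measure \<mu> UNIV = 1"
    using prob_space space by simp
  ultimately have "\<forall>\<^sub>F k in sequentially. 1 - \<alpha> < measure \<mu> (cball 0 (real k))"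
    using \<open>0 < \<alpha>\<close> by (intro order_tendstoD(1)) auto
  then obtain k where "1 - \<alpha> < measure \<mu> (cball 0 (real k))"
    using eventually_happens by force
  then have "cball 0 (real k) \<in> heavy_sets \<mu> \<alpha>"
    by (simp add: heavy_sets_def)
  then show thesis by (rule that)
qed

text \<open>
  A heavy ball cuts \<open>S\<close> down to a compact set, on which the finite intersection property applies.
\<close>

lemma deep_point_if_heavy_fip:
  fixes \<mu> :: "(real ^ 'n) measure"
  assumes "prob_space \<mu>" and "sets \<mu> = sets borel" and "closed S" and "0 < \<alpha>"
    and fip: "\<And>G. \<lbrakk>finite G; G \<noteq> {}; G \<subseteq> heavy_sets \<mu> \<alpha>\<rbrakk> \<Longrightarrow> S \<inter> \<Inter>G \<noteq> {}"
  obtains x where "x \<in> S" and "\<alpha> \<le> halfspace_depth \<mu> x"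
proof -
  obtain r where r: "cball 0 r \<in> heavy_sets \<mu> \<alpha>"
    using cball_heavy[OF assms(1,2,4)] .
  have "(S \<inter> cball 0 r) \<inter> \<Inter>(heavy_sets \<mu> \<alpha>) \<noteq> {}"
  proof (rule compact_imp_fip)
    show "compact (S \<inter> cball 0 r)"
      using \<open>closed S\<close> by (simp add: closed_Int_compact)
    show "closed K" if "K \<in> heavy_sets \<mu> \<alpha>" for K
      using that by (rule heavy_setsD(1))
    show "(S \<inter> cball 0 r) \<inter> \<Inter>G \<noteq> {}" if "finite G" "G \<subseteq> heavy_sets \<mu> \<alpha>" for G
      using fip[of "insert (cball 0 r) G"] that r by (simp add: Int_assoc)
  qed
  then show thesis
    using le_halfspace_depth_iff[OF assms(1,2)] that by blast
qed

section \<open>The Helly number as a depth bound\<close>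

text \<open>For \<open>h = 0\<close> the hypothesis on subfamilies is vacuous, yet the single trace \<open>{}\<close> is empty.\<close>

lemma helly_property_pos:
  assumes "helly_property S h"
  shows "0 < h"
proof (rule ccontr)
  assume "\<not> 0 < h"
  moreover have "{} \<in> convex_traces S"
    unfolding convex_traces_def using convex_empty by blast
  ultimately have "(\<Inter>k \<in> {1..1 :: nat}. {} :: (real ^ 'a) set) \<noteq> {}"
    using assms[unfolded helly_property_def, rule_format, of 1 "\<lambda>_. {}"] by simp
  then show False by simp
qed

text \<open>The union bound for the complements of the \<open>h\<close> sets and of \<open>S\<close>.\<close>

lemma few_heavy_sets_meet:
  fixes \<mu> :: "(real ^ 'n) measure"
  assumes "prob_space \<mu>" and sets: "sets \<mu> = sets borel"
    and "closed S" and null: "emeasure \<mu> (UNIV - S) = 0" and "0 < h"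
    and heavy: "\<And>j. j \<in> {1..h} \<Longrightarrow> A j \<in> heavy_sets \<mu> (inverse (real h))"
  shows "(\<Inter>j \<in> {1..h}. S \<inter> A j) \<noteq> {}"
proof
  assume empty: "(\<Inter>j \<in> {1..h}. S \<inter> A j) = {}"
  interpret prob_space \<mu> by fact
  have space: "space \<mu> = UNIV"
    using sets_eq_imp_space_eq[OF sets] by simp
  have meas: "A j \<in> sets \<mu>" if "j \<in> {1..h}" for j
    using heavy_setsD(1)[OF heavy[OF that]] by (simp add: sets)
  have compl_meas: "UNIV - A j \<in> sets \<mu>" if "j \<in> {1..h}" for j
    using sets.compl_sets[OF meas[OF that]] by (simp add: space)
  have S_meas: "UNIV - S \<in> sets \<mu>"
    using \<open>closed S\<close> by (simp add: sets)
  have compl: "measure \<mu> (UNIV - A j) < inverse (real h)" if "j \<in> {1..h}" for j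
    using prob_compl[OF meas[OF that]] heavy_setsD(3)[OF heavy[OF that]]
    by (simp add: space)
  have cover: "(UNIV - S) \<union> (\<Union>j \<in> {1..h}. UNIV - A j) = UNIV"
    using empty \<open>0 < h\<close> by fastforce
  have "1 = measure \<mu> ((UNIV - S) \<union> (\<Union>j \<in> {1..h}. UNIV - A j))"
    unfolding cover using prob_space space by simp
  also have "\<dots> \<le> measure \<mu> (UNIV - S) + measure \<mu> (\<Union>j \<in> {1..h}. UNIV - A j)"
    using S_meas compl_meas by (intro measure_Un_le sets.finite_UN) blast+
  also have "measure \<mu> (UNIV - S) = 0"
    using null by (simp add: measure_def)
  also have "measure \<mu> (\<Union>j \<in> {1..h}. UNIV - A j) \<le> (\<Sum>j \<in> {1..h}. measure \<mu> (UNIV - A j))"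
    using compl_meas by (intro finite_measure_subadditive_finite) auto
  also have "(\<Sum>j \<in> {1..h}. measure \<mu> (UNIV - A j)) < (\<Sum>j \<in> {1..h}. inverse (real h))"
    using \<open>0 < h\<close> compl by (intro sum_strict_mono) auto
  also have "\<dots> = 1"
    using \<open>0 < h\<close> by simp
  finally show False by simp
qed

lemma deep_point_if_helly:
  fixes \<mu> :: "(real ^ 'n) measure"
  assumes "prob_space \<mu>" and "sets \<mu> = sets borel"
    and "closed S" and "emeasure \<mu> (UNIV - S) = 0" and helly: "helly_property S h"
  obtains x where "x \<in> S" and "inverse (real h) \<le> halfspace_depth \<mu> x"
proof (rule deep_point_if_heavy_fip[OF assms(1-3), of "inverse (real h)"])
  have h: "0 < h"
    using helly by (rule helly_property_pos)
  then show "0 < inverse (real h)" by simp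
  fix G assume G: "finite G" "G \<noteq> {}" "G \<subseteq> heavy_sets \<mu> (inverse (real h))"
  define m where "m = card G"
  obtain K where "bij_betw K {1..m} G"
    using ex_bij_betw_nat_finite_1[OF G(1)] m_def by blast
  then have K: "K ` {1..m} = G"
    by (rule bij_betw_imp_surj_on)
  then have K_heavy: "K k \<in> heavy_sets \<mu> (inverse (real h))" if "k \<in> {1..m}" for k
    using G(3) that by blast
  have "(\<Inter>k \<in> {1..m}. S \<inter> K k) \<noteq> {}"
  proof (rule helly[unfolded helly_property_def, rule_format])
    show "S \<inter> K k \<in> convex_traces S" if "k \<in> {1..m}" for k
      using heavy_setsD(2)[OF K_heavy[OF that]] by (auto simp: convex_traces_def)
    show "(\<Inter>j \<in> {1..h}. S \<inter> K (i j)) \<noteq> {}" if "\<And>j. j \<in> {1..h} \<Longrightarrow> i j \<in> {1..m}" for i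
      using few_heavy_sets_meet[OF assms(1-4) h, of "\<lambda>j. K (i j)"] K_heavy that by blast
  qed
  moreover have "(\<Inter>k \<in> {1..m}. S \<inter> K k) = S \<inter> \<Inter>G"
    using G(2) K by blast
  ultimately show "S \<inter> \<Inter>G \<noteq> {}" by simp
qed

section \<open>The maximal depth is attained\<close>

lemma halfspace_depth_le_one:
  assumes "prob_space \<mu>"
  shows "halfspace_depth \<mu> x \<le> 1"
proof -
  obtain u :: "real ^ 'a" where "u \<in> sphere 0 1"
    using sphere_cart_nonempty by blast
  from halfspace_depth_le[OF this] prob_space.prob_le_1[OF assms]
  show ?thesis by (rule order_trans)
qed

text \<open>
  Positivity of the depth somewhere on \<open>S\<close> provides the heavy ball that keeps a maximizing
  sequence from escaping to infinity.
\<close>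

lemma halfspace_depth_attains_sup:
  fixes \<mu> :: "(real ^ 'n) measure"
  assumes "prob_space \<mu>" and "sets \<mu> = sets borel" and "closed S"
    and x0: "x0 \<in> S" "0 < halfspace_depth \<mu> x0"
  obtains x where "x \<in> S" and "\<And>y. y \<in> S \<Longrightarrow> halfspace_depth \<mu> y \<le> halfspace_depth \<mu> x"
proof -
  define d where "d = (SUP y \<in> S. halfspace_depth \<mu> y)"
  have bdd: "bdd_above (halfspace_depth \<mu> ` S)"
    using halfspace_depth_le_one[OF assms(1)] by (rule bdd_aboveI2)
  have le_d: "halfspace_depth \<mu> y \<le> d" if "y \<in> S" for y
    unfolding d_def using that bdd by (rule cSUP_upper)
  obtain x where "x \<in> S" "d \<le> halfspace_depth \<mu> x"
  proof (rule deep_point_if_heavy_fip[OF assms(1-3)])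
    show "0 < d"
      using x0(2) le_d[OF x0(1)] by simp
    fix G assume G: "finite G" "G \<noteq> {}" "G \<subseteq> heavy_sets \<mu> d"
    \<comment> \<open>The lightest member of \<open>G\<close> determines a level below \<open>d\<close> at which all members are
      still heavy.\<close>
    define w where "w = Min (measure \<mu> ` G)"
    have "1 - d < w"
      using G heavy_setsD(3) by (auto simp: w_def)
    then obtain a where a: "1 - w < a" "a < d"
      using dense[of "1 - w" d] by auto
    then obtain y where y: "y \<in> S" "a \<le> halfspace_depth \<mu> y"
      using less_cSUP_iff[OF _ bdd, of a] x0(1) by (force simp: d_def)
    have "K \<in> heavy_sets \<mu> a" if "K \<in> G" for K
    proof -
      have "w \<le> measure \<mu> K"
        using G(1) that by (simp add: w_def)
      with a(1) G(3) that show ?thesis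
        by (auto simp: heavy_sets_def)
    qed
    then show "S \<inter> \<Inter>G \<noteq> {}"
      using y le_halfspace_depth_iff[OF assms(1,2)] by blast
  qed
  then show thesis
    using le_d that by (meson order_trans)
qed

theorem theorem15:
  fixes S :: "(real ^ 'n) set" and \<mu> :: "(real ^ 'n) measure"
  assumes "S \<noteq> {}" and "closed S"
    and "prob_space \<mu>" and "sets \<mu> = sets borel"
    and "emeasure \<mu> (UNIV - S) = 0"
    and "helly_number S < \<infinity>"
  shows "max_depth S \<mu> \<ge> inverse (real (the_enat (helly_number S)))"
proof -
  define h where "h = the_enat (helly_number S)"
  have "\<exists>h. helly_property S h"
    using assms(6) by (auto simp: helly_number_def split: if_splits)
  then have helly: "helly_property S h"
    by (auto simp: h_def helly_number_def intro: LeastI)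
  obtain x0 where x0: "x0 \<in> S" "inverse (real h) \<le> halfspace_depth \<mu> x0"
    using deep_point_if_helly[OF assms(3,4,2,5) helly] .
  have "0 < inverse (real h)"
    using helly_property_pos[OF helly] by simp
  with x0(2) have "0 < halfspace_depth \<mu> x0" by linarith
  then obtain x where x: "x \<in> S" "\<And>y. y \<in> S \<Longrightarrow> halfspace_depth \<mu> y \<le> halfspace_depth \<mu> x"
    using halfspace_depth_attains_sup[OF assms(3,4,2) x0(1)] by blast
  have "max_depth S \<mu> = halfspace_depth \<mu> x"
    unfolding max_depth_def using x by (intro Greatest_equality) auto
  with x0 x(2)[of x0] show ?thesis
    by (simp add: h_def)
qed

end
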